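(* Let $G$ be a separable locally compact group admitting an invariant metric, and let $X\subseteq G$. The following are equivalent: (i) $X$ is $\mathcal M$-additive; (ii) $X$ is sharply $\mathcal M$-additive; (iii) $X$ has sharp measure zero.
   Context: An invariant metric is a metric compatible with the topology that is both left- and right-invariant. For $A,B\subseteq G$, $AB=\{ab:a\in A,b\in B\}$. A set is meager if it is a countable union of nowhere dense sets. A set $X\subseteq G$ is $\mathcal M$-additive (meager-additive) if $MX$ is meager for every meager set $M\subseteq G$. It is sharply $\mathcal M$-additive if for every meager set $M\subseteq G$ there is a $\sigma$-compact set $K\supseteq X$ such that $MK$ is meager. Sharp measure zero: a sequence $\langle U_n:n\in\omega\rangle$ of sets is a $\gamma$-cover of $X$ if each $x\in X$ belongs to all but finitely many $U_n$; it is a $\gamma$-groupable cover of $X$ if there is a partition $\omega=I_0\cup I_1\cup I_2\cup\dots$ into consecutive finite intervals ($I_{j+1}$ to the right of $I_j$) such that $\langle\bigcup_{n\in I_j}U_n:j\in\omega\rangle$ is a $\gamma$-cover of $X$. A metric space $X$ (or a subset of a metric space, with the restricted metric) has sharp measure zero if for every sequence $\langle\varepsilon_n\rangle$ of positive reals there is a $\gamma$-groupable cover $\langle U_n\rangle$ of $X$ with $\operatorname{diam}U_n\leq\varepsilon_n$ for all $n$. In a separable locally compact metrizable group this does not depend on the choice of the metric compatible with the topology, so no metric is specified; any compatible metric may be used. *)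

theory Defs
  imports "HOL-Analysis.Analysis"
begin

text \<open>
  Groups are written additively, as in the library class of topological groups;
  \<open>group_add\<close> does not assume commutativity. The product \<open>AB\<close> of two subsets is the
  set sum \<open>A + B\<close> of HOL-Library's \<open>Set_Algebras\<close>.
\<close>

definition nowhere_dense :: "'a::topological_space set \<Rightarrow> bool" where
  "nowhere_dense A \<longleftrightarrow> interior (closure A) = {}"

definition meager :: "'a::topological_space set \<Rightarrow> bool" where
  "meager M \<longleftrightarrow> (\<exists>N :: nat \<Rightarrow> 'a set. (\<forall>n. nowhere_dense (N n)) \<and> M = (\<Union>n. N n))"

definition sigma_compact :: "'a::topological_space set \<Rightarrow> bool" where
  "sigma_compact K \<longleftrightarrow> (\<exists>C :: nat \<Rightarrow> 'a set. (\<forall>n. compact (C n)) \<and> K = (\<Union>n. C n))"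

definition meager_additive :: "'a::topological_group_add set \<Rightarrow> bool" where
  "meager_additive X \<longleftrightarrow> (\<forall>M. meager M \<longrightarrow> meager (M + X))"

definition sharply_meager_additive :: "'a::topological_group_add set \<Rightarrow> bool" where
  "sharply_meager_additive X \<longleftrightarrow>
     (\<forall>M. meager M \<longrightarrow> (\<exists>K. sigma_compact K \<and> X \<subseteq> K \<and> meager (M + K)))"

definition gamma_cover :: "'a set \<Rightarrow> (nat \<Rightarrow> 'a set) \<Rightarrow> bool" where
  "gamma_cover X U \<longleftrightarrow> (\<forall>x\<in>X. finite {n. x \<notin> U n})"

text \<open>
  A partition of \<open>\<omega>\<close> into consecutive finite intervals is given by the left endpoints
  \<open>0 = k 0 < k 1 < \<dots>\<close>, the \<open>j\<close>-th interval being \<open>{k j..<k (Suc j)}\<close>.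
\<close>

definition gamma_groupable_cover :: "'a set \<Rightarrow> (nat \<Rightarrow> 'a set) \<Rightarrow> bool" where
  "gamma_groupable_cover X U \<longleftrightarrow>
     (\<exists>k :: nat \<Rightarrow> nat. k 0 = 0 \<and> strict_mono k \<and>
        gamma_cover X (\<lambda>j. \<Union>n\<in>{k j..<k (Suc j)}. U n))"

text \<open>
  The library's real-valued \<open>diameter\<close> carries no information for unbounded sets, whose
  diameter is infinite; hence the boundedness requirement. Requiring \<open>U n \<subseteq> X\<close> makes
  this the notion for \<open>X\<close> as a metric space with the restricted metric.
\<close>

definition sharp_measure_zero :: "'a::metric_space set \<Rightarrow> bool" where
  "sharp_measure_zero X \<longleftrightarrow>
     (\<forall>\<epsilon> :: nat \<Rightarrow> real. (\<forall>n. 0 < \<epsilon> n) \<longrightarrow>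
        (\<exists>U. (\<forall>n. U n \<subseteq> X \<and> bounded (U n) \<and> diameter (U n) \<le> \<epsilon> n) \<and>
             gamma_groupable_cover X U))"

text \<open>
  The invariant metric \<open>d\<close> is required to induce the topology of the type, but need not
  be the metric \<open>dist\<close>. For a type of sort \<open>{topological_group_add, metric_space}\<close>,
  \<open>dist\<close> is thus an arbitrary metric compatible with the topology.
\<close>

definition invariant_metric :: "('a::topological_group_add \<Rightarrow> 'a \<Rightarrow> real) \<Rightarrow> bool" where
  "invariant_metric d \<longleftrightarrow>
     Metric_space UNIV d \<and> Metric_space.mtopology UNIV d = euclidean \<and>
     (\<forall>g x y. d (g + x) (g + y) = d x y) \<and>
     (\<forall>g x y. d (x + g) (y + g) = d x y)"

end

theory Submission
  imports Defs
begin

text \<open>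
  Fix a bi-invariant metric \<open>d\<close> and an increasing sequence of compact sets \<open>C n\<close> that exhausts
  the group. On each \<open>C n\<close> the metrics \<open>d\<close> and \<open>dist\<close> are uniformly equivalent
  (\<open>compact_zero_set_modulus\<close>), and every point lies in almost all \<open>C n\<close>; cutting the \<open>n\<close>-th
  set of a cover down to \<open>C n\<close> therefore allows its diameter to be measured in \<open>d\<close>. A sharply
  meager-additive set is meager-additive because subsets of meager sets are meager. The two
  remaining implications are as follows.

  Sharp measure zero implies sharply meager-additive. Cover the meager set by increasing
  compact nowhere dense sets \<open>F n\<close>. By compactness and invariance, all balls of a given radius
  contain holes of \<open>F n\<close> of one common radius (\<open>compact_nowhere_dense_uniform_holes\<close>), and as a
  set \<open>U\<close> of small diameter is almost a point, \<open>F n + U\<close> has uniform holes as well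
  (\<open>holes_of_sum_with_small_set\<close>). If the diameters of the \<open>U n\<close> decrease fast enough, then
  walking through the indices of one group and shrinking the ball at each of them yields a
  hole of \<open>F i + (\<Union>n\<in>J. U n)\<close>, where \<open>J\<close> is the group. Hence \<open>F i + K\<close> is nowhere dense for any
  set \<open>K\<close> that is covered by almost every group, and \<open>X\<close> lies in countably many compact sets
  of this kind.

  Meager-additive implies sharp measure zero. The given diameters are spent on a closed
  nowhere dense set \<open>M\<close>, obtained by removing tiny balls around the points of a dense sequence
  \<open>q\<close> (\<open>hole_sequence\<close>). Let \<open>M + X\<close> be covered by closed nowhere dense sets \<open>N l\<close>. For each
  \<open>x \<in> X\<close> the Baire theorem on \<open>M\<close> gives a basic open set \<open>V a\<close> meeting \<open>M\<close> and an \<open>l\<close> such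
  that \<open>(V a \<inter> M) + x \<subseteq> N l\<close>. So \<open>X\<close> splits into countably many pieces, on each of which \<open>a\<close>,
  \<open>l\<close> and some \<open>C i\<close> containing the piece are constant. For \<open>s\<close> large, let \<open>W\<close> be \<open>V a\<close>
  without the first \<open>s\<close> balls. Finitely many points \<open>z\<close> outside \<open>N l\<close> suffice for each \<open>x \<in> C i\<close>
  to have some \<open>z - x\<close> in \<open>W\<close>; and for \<open>x\<close> in the piece, \<open>z - x\<close> cannot belong to \<open>M\<close>, so it
  falls into a ball with index at least \<open>s\<close>. The piece is thus covered by reflected translates
  of late balls. The number of points \<open>z\<close> does not depend on \<open>N l\<close>
  (\<open>ex_translates_avoiding\<close>), so it is known when the ball of index \<open>s\<close> is chosen, and the radius
  can be adapted to the number of translates that will be needed. Since \<open>s\<close> is arbitrary,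
  each piece is covered by finitely many admissible sets with indices beyond any bound, and
  such pieces combine to a groupable cover (\<open>gamma_groupable_cover_from_pieces\<close>).
\<close>

section \<open>Category and diameters\<close>

lemma nowhere_dense_iff_avoids:
  "nowhere_dense A \<longleftrightarrow>
     (\<forall>S. open S \<and> S \<noteq> {} \<longrightarrow> (\<exists>T. open T \<and> T \<noteq> {} \<and> T \<subseteq> S \<and> T \<inter> A = {}))"
proof
  assume nd: "nowhere_dense A"
  show "\<forall>S. open S \<and> S \<noteq> {} \<longrightarrow> (\<exists>T. open T \<and> T \<noteq> {} \<and> T \<subseteq> S \<and> T \<inter> A = {})"
  proof (intro allI impI)
    fix S :: "'a set" assume S: "open S \<and> S \<noteq> {}"
    then have "\<not> S \<subseteq> closure A"
      using nd interior_maximal[of S "closure A"] unfolding nowhere_dense_def by auto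
    then show "\<exists>T. open T \<and> T \<noteq> {} \<and> T \<subseteq> S \<and> T \<inter> A = {}"
      using S closure_subset[of A] by (intro exI[of _ "S - closure A"]) (auto intro: open_Diff)
  qed
next
  assume *: "\<forall>S. open S \<and> S \<noteq> {} \<longrightarrow> (\<exists>T. open T \<and> T \<noteq> {} \<and> T \<subseteq> S \<and> T \<inter> A = {})"
  show "nowhere_dense A"
    unfolding nowhere_dense_def
  proof (rule ccontr)
    assume "interior (closure A) \<noteq> {}"
    then obtain T where T: "open T" "T \<noteq> {}" "T \<subseteq> interior (closure A)" "T \<inter> A = {}"
      using * open_interior by metis
    then have "T \<inter> closure A = {}"
      using open_Int_closure_eq_empty by blast
    then show False
      using T interior_subset by blast
  qed
qed

lemma nowhere_dense_subset: "nowhere_dense B \<Longrightarrow> A \<subseteq> B \<Longrightarrow> nowhere_dense A"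
  unfolding nowhere_dense_iff_avoids by (meson disjoint_iff subset_iff)

lemma nowhere_dense_closure: "nowhere_dense A \<Longrightarrow> nowhere_dense (closure A)"
  by (simp add: nowhere_dense_def)

lemma nowhere_dense_empty: "nowhere_dense {}"
  by (simp add: nowhere_dense_def)

lemma nowhere_dense_Un:
  assumes "nowhere_dense A" "nowhere_dense B"
  shows "nowhere_dense (A \<union> B)"
  unfolding nowhere_dense_iff_avoids
proof (intro allI impI)
  fix S :: "'a set" assume "open S \<and> S \<noteq> {}"
  then obtain T where T: "open T \<and> T \<noteq> {}" "T \<subseteq> S" "T \<inter> A = {}"
    using assms(1) unfolding nowhere_dense_iff_avoids by metis
  then obtain T' where "open T' \<and> T' \<noteq> {}" "T' \<subseteq> T" "T' \<inter> B = {}"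
    using assms(2) unfolding nowhere_dense_iff_avoids by metis
  then show "\<exists>T. open T \<and> T \<noteq> {} \<and> T \<subseteq> S \<and> T \<inter> (A \<union> B) = {}"
    using T by (intro exI[of _ T']) blast
qed

lemma nowhere_dense_UN_atMost:
  fixes N :: "nat \<Rightarrow> 'a::topological_space set"
  assumes "\<And>l. nowhere_dense (N l)"
  shows "nowhere_dense (\<Union>l\<le>n. N l)"
  by (induction n) (auto simp: atMost_Suc intro!: nowhere_dense_Un assms)

lemma meager_if_covered:
  assumes "countable I" "\<And>i. i \<in> I \<Longrightarrow> nowhere_dense (N i)" "A \<subseteq> (\<Union>i\<in>I. N i)"
  shows "meager A"
proof (cases "I = {}")
  case True
  then show ?thesis
    using assms nowhere_dense_empty unfolding meager_def by (intro exI[of _ "\<lambda>_. {}"]) auto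
next
  case False
  have "A = (\<Union>n. N (from_nat_into I n) \<inter> A)"
  proof
    show "A \<subseteq> (\<Union>n. N (from_nat_into I n) \<inter> A)"
    proof
      fix x assume x: "x \<in> A"
      then obtain i where "i \<in> I" "x \<in> N i"
        using assms(3) by blast
      moreover from this obtain n where "from_nat_into I n = i"
        using from_nat_into_surj[OF assms(1)] by blast
      ultimately show "x \<in> (\<Union>n. N (from_nat_into I n) \<inter> A)"
        using x by blast
    qed
  qed blast
  moreover have "nowhere_dense (N (from_nat_into I n) \<inter> A)" for n
    using nowhere_dense_subset[OF assms(2)[OF from_nat_into[OF False]]] by blast
  ultimately show ?thesis
    unfolding meager_def by (intro exI[of _ "\<lambda>n. N (from_nat_into I n) \<inter> A"]) blast
qed

lemma meager_subset:
  assumes "meager B" "A \<subseteq> B"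
  shows "meager A"
proof -
  obtain N :: "nat \<Rightarrow> 'a set" where "\<forall>n. nowhere_dense (N n)" "B = (\<Union>n. N n)"
    using assms(1) unfolding meager_def by blast
  then show ?thesis
    using assms(2) by (intro meager_if_covered[of "UNIV :: nat set" N]) auto
qed

lemma bounded_diameter_le:
  fixes U :: "'a::metric_space set"
  assumes "0 \<le> e" "\<And>x y. x \<in> U \<Longrightarrow> y \<in> U \<Longrightarrow> dist x y \<le> e"
  shows "bounded U \<and> diameter U \<le> e"
proof
  show "bounded U"
  proof (cases "U = {}")
    case False
    then obtain a where "a \<in> U" by blast
    then show ?thesis
      using assms(2) bounded_def by blast
  qed simp
  show "diameter U \<le> e"
    unfolding diameter_def using assms by (auto intro!: cSUP_least)
qed

text \<open>
  Compactness makes two continuous functions with nested zero sets comparable. Applied to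
  two metrics of the same topology on \<open>C \<times> C\<close>, it lets diameters be prescribed in either
  metric as long as the sets stay in a fixed compact set.
\<close>

lemma compact_zero_set_modulus:
  fixes f g :: "'a::topological_space \<Rightarrow> real"
  assumes D: "compact D" and f: "continuous_on D f" and g: "continuous_on D g"
    and nonneg: "\<And>p. p \<in> D \<Longrightarrow> 0 \<le> g p" and zero: "\<And>p. p \<in> D \<Longrightarrow> g p = 0 \<Longrightarrow> f p = 0"
    and e: "0 < e"
  shows "\<exists>h>0. \<forall>p\<in>D. g p < h \<longrightarrow> f p < e"
proof -
  let ?E = "D \<inter> f -` {e..}"
  have cE: "compact ?E"
  proof -
    have "closedin (top_of_set D) ?E"
      using f by (simp add: continuous_closedin_preimage)
    then show ?thesis
      using D closedin_compact by blast
  qed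
  show ?thesis
  proof (cases "?E = {}")
    case True
    then show ?thesis by (intro exI[of _ 1]) (auto simp: not_le[symmetric])
  next
    case False
    then obtain p where p: "p \<in> ?E" "\<forall>q\<in>?E. g p \<le> g q"
      using continuous_attains_inf[OF cE False continuous_on_subset[OF g]] by auto
    have "g p \<noteq> 0"
      using p zero e by fastforce
    then have "0 < g p"
      using nonneg[of p] p by auto
    then show ?thesis
      using p by (intro exI[of _ "g p"]) (auto simp: not_le[symmetric])
  qed
qed

section \<open>Countable bases and compact exhaustions\<close>

lemma countable_base_sequence:
  assumes "separable_space (euclidean :: 'a::metric_space topology)"
  shows "\<exists>V :: nat \<Rightarrow> 'a set. (\<forall>n. open (V n)) \<and>
           (\<forall>S x. open S \<and> x \<in> S \<longrightarrow> (\<exists>n. x \<in> V n \<and> V n \<subseteq> S))"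
proof -
  obtain D :: "'a set" where D: "countable D" "closure D = UNIV"
    using assms unfolding separable_space_def by auto
  have ne: "D \<noteq> {}" using D(2) by auto
  define q where "q = from_nat_into D"
  have q: "range q = D"
    unfolding q_def using D(1) ne by (simp add: range_from_nat_into)
  define V where "V n = ball (q (fst (prod_decode n))) (1 / real (Suc (snd (prod_decode n))))" for n
  have "\<exists>n. x \<in> V n \<and> V n \<subseteq> S" if S: "open S" "x \<in> S" for S x
  proof -
    obtain e where e: "e > 0" "ball x e \<subseteq> S"
      using S openE by blast
    obtain j where j: "1 / real (Suc j) < e / 2"
      using e(1) nat_approx_posE[of "e/2"] by auto
    have "x \<in> closure D" using D(2) by simp
    then obtain y where "y \<in> D" "dist y x < 1 / real (Suc j)"
      unfolding closure_approachable by (meson of_nat_0_less_iff zero_less_Suc zero_less_divide_1_iff)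
    then obtain i where i: "dist (q i) x < 1 / real (Suc j)"
      using q by auto
    have "V (prod_encode (i, j)) \<subseteq> ball x e"
    proof
      fix z assume "z \<in> V (prod_encode (i, j))"
      then have "dist (q i) z < 1 / real (Suc j)" by (simp add: V_def)
      then show "z \<in> ball x e"
        using i j dist_triangle3[of x z "q i"] by (simp add: dist_commute)
    qed
    then show ?thesis
      using e(2) i by (intro exI[of _ "prod_encode (i, j)"]) (auto simp: V_def)
  qed
  then show ?thesis
    by (intro exI[of _ V]) (auto simp: V_def)
qed

lemma compact_exhaustion_sequence:
  assumes "separable_space (euclidean :: 'a::metric_space topology)"
    and "locally_compact_space (euclidean :: 'a topology)"
  shows "\<exists>C :: nat \<Rightarrow> 'a set. (\<forall>n. compact (C n)) \<and> mono C \<and> (\<Union>n. C n) = UNIV"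
proof -
  obtain V :: "nat \<Rightarrow> 'a set"
    where V: "\<forall>S x. open S \<and> x \<in> S \<longrightarrow> (\<exists>n. x \<in> V n \<and> V n \<subseteq> S)"
    using countable_base_sequence[OF assms(1)] by (elim exE conjE)
  define K where "K n = (if \<exists>L. compact L \<and> V n \<subseteq> L then SOME L. compact L \<and> V n \<subseteq> L else {})" for n
  have cK: "compact (K n)" for n
  proof (cases "\<exists>L. compact L \<and> V n \<subseteq> L")
    case True
    then show ?thesis
      using someI_ex[OF True] by (simp add: K_def)
  next
    case False
    then have "K n = {}" unfolding K_def by (rule if_not_P)
    then show ?thesis by simp
  qed
  have VK: "V n \<subseteq> K n" if "compact L" "V n \<subseteq> L" for n L
  proof -
    have ex: "\<exists>L. compact L \<and> V n \<subseteq> L"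
      using that by blast
    then show ?thesis
      using someI_ex[OF ex] by (simp add: K_def)
  qed
  have "\<exists>n. x \<in> K n" for x
  proof -
    obtain S L where "open S" "compact L" "x \<in> S" "S \<subseteq> L"
      using assms(2) unfolding locally_compact_space_def
      by (metis compactin_euclidean_iff open_openin topspace_euclidean UNIV_I)
    moreover from this obtain n where "x \<in> V n" "V n \<subseteq> S"
      using V by blast
    ultimately show ?thesis
      using VK by blast
  qed
  then have "(\<Union>n. \<Union>l\<le>n. K l) = UNIV" by blast
  moreover have "mono (\<lambda>n. \<Union>l\<le>n. K l)" by (intro monoI UN_mono) auto
  moreover have "compact (\<Union>l\<le>n. K l)" for n by (auto intro: cK)
  ultimately show ?thesis by (intro exI[of _ "\<lambda>n. \<Union>l\<le>n. K l"] conjI allI)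
qed

section \<open>Bi-invariant metrics\<close>

locale biinvariant_metric =
  fixes d :: "'a::{topological_group_add, metric_space} \<Rightarrow> 'a \<Rightarrow> real"
  assumes invariant: "invariant_metric d"
begin

lemma metric: "Metric_space UNIV d"
  and mtopology: "Metric_space.mtopology UNIV d = euclidean"
  using invariant by (auto simp: invariant_metric_def)

lemma d_left: "d (g + x) (g + y) = d x y"
  and d_right: "d (x + g) (y + g) = d x y"
  using invariant by (auto simp: invariant_metric_def)

lemma d_right_diff: "d (x - g) (y - g) = d x y"
  using d_right[of x "- g" y] by simp

lemma d_nonneg: "0 \<le> d x y"
  using metric by (simp add: Metric_space.nonneg)

lemma d_sym: "d x y = d y x"
  using metric by (simp add: Metric_space.commute)

lemma d_zero: "d x y = 0 \<longleftrightarrow> x = y"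
  using metric by (simp add: Metric_space.zero)

lemma d_triangle: "d x z \<le> d x y + d y z"
  using Metric_space.triangle[OF metric] by simp

text \<open>
  Invariance on both sides makes inversion an isometry: translate \<open>- x\<close> and \<open>- y\<close> by \<open>x\<close> on the
  left and by \<open>y\<close> on the right.
\<close>

lemma d_left_diff: "d (z - x) (z - y) = d x y"
proof -
  have "d (z - x) (z - y) = d (- x) (- y)"
    using d_left[of z "- x" "- y"] by simp
  also have "\<dots> = d (x + (- x + y)) (x + (- y + y))"
    by (simp only: d_left d_right)
  also have "\<dots> = d x y"
    by (simp add: d_sym add.assoc[symmetric])
  finally show ?thesis .
qed

definition dball :: "'a \<Rightarrow> real \<Rightarrow> 'a set" where
  "dball x r = {y. d x y < r}"

lemma mem_dball: "y \<in> dball x r \<longleftrightarrow> d x y < r"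
  by (simp add: dball_def)

lemma centre_in_dball: "0 < r \<Longrightarrow> x \<in> dball x r"
  using d_zero[of x x] by (simp add: mem_dball)

lemma dball_subset: "d x y + s \<le> r \<Longrightarrow> dball y s \<subseteq> dball x r"
  using d_triangle[of x _ y] by (smt (verit) mem_dball subsetI)

lemma open_dball: "open (dball x r)"
  using Metric_space.openin_mball[OF metric, of x r] mtopology
  by (simp add: Metric_space.mball_def[OF metric] dball_def)

lemma open_contains_dball:
  assumes "open S" "x \<in> S"
  shows "\<exists>r>0. dball x r \<subseteq> S"
proof -
  have "openin (Metric_space.mtopology UNIV d) S"
    using assms(1) mtopology by simp
  then show ?thesis
    using assms(2) unfolding Metric_space.openin_mtopology[OF metric]
    by (simp add: Metric_space.mball_def[OF metric] dball_def)
qed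

lemma continuous_on_d:
  assumes "continuous_on S f" "continuous_on S g"
  shows "continuous_on S (\<lambda>p. d (f p) (g p))"
proof -
  have t: "mtopology_of (metric (UNIV, d)) = euclidean"
    by (simp add: mtopology_of_def mtopology Metric_space.mspace_metric[OF metric]
        Metric_space.mdist_metric[OF metric])
  have "continuous_map (top_of_set S) euclidean (\<lambda>p. mdist (metric (UNIV, d)) (f p) (g p))"
    using assms by (intro continuous_map_mdist) (simp_all add: t)
  then show ?thesis
    by (simp add: Metric_space.mdist_metric[OF metric])
qed

lemma closed_dcball: "closed {y. d x y \<le> r}"
  by (intro closed_Collect_le continuous_on_d continuous_intros)

lemma dist_modulus_on_compact:
  assumes "compact C" "0 < e"
  shows "\<exists>h>0. \<forall>x\<in>C. \<forall>y\<in>C. d x y < h \<longrightarrow> dist x y < e"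
proof -
  have "\<exists>h>0. \<forall>p\<in>C \<times> C. d (fst p) (snd p) < h \<longrightarrow> dist (fst p) (snd p) < e"
    using assms by (intro compact_zero_set_modulus compact_Times continuous_on_d continuous_intros)
       (auto simp: d_nonneg d_zero)
  then show ?thesis by auto
qed

lemma d_modulus_on_compact:
  assumes "compact C" "0 < e"
  shows "\<exists>h>0. \<forall>x\<in>C. \<forall>y\<in>C. dist x y < h \<longrightarrow> d x y < e"
proof -
  have "\<exists>h>0. \<forall>p\<in>C \<times> C. dist (fst p) (snd p) < h \<longrightarrow> d (fst p) (snd p) < e"
    using assms by (intro compact_zero_set_modulus compact_Times continuous_on_d continuous_intros)
       (auto simp: d_zero)
  then show ?thesis by auto
qed

lemma compact_finite_dnet:
  assumes "compact C" "0 < r"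
  shows "\<exists>F. finite F \<and> F \<subseteq> C \<and> C \<subseteq> (\<Union>c\<in>F. dball c r)"
proof -
  have "C \<subseteq> (\<Union>c\<in>C. dball c r)"
    using centre_in_dball[OF assms(2)] by blast
  then obtain F where "F \<subseteq> C" "finite F" "C \<subseteq> (\<Union>c\<in>F. dball c r)"
    using compactE_image[OF assms(1), of C "\<lambda>c. dball c r"] open_dball by metis
  then show ?thesis by blast
qed

section \<open>Sharp measure zero implies sharply meager-additive\<close>

text \<open>
  Only balls near \<open>F\<close> matter, since a ball whose inner half misses \<open>F\<close> has a concentric hole. The
  others contain one of the finitely many balls of a net of \<open>F\<close>, and each of these has a hole.
\<close>

lemma compact_nowhere_dense_uniform_holes:
  assumes F: "compact F" "nowhere_dense F" and e: "0 < e"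
  shows "\<exists>r>0. \<forall>x. \<exists>y. dball y r \<subseteq> dball x e - F"
proof -
  obtain N where N: "finite N" "F \<subseteq> (\<Union>c\<in>N. dball c (e / 4))"
    using compact_finite_dnet[OF F(1), of "e / 4"] e by auto
  have "\<exists>y s. 0 < s \<and> dball y s \<subseteq> dball c (e / 4) - F" for c
  proof -
    have "open (dball c (e / 4)) \<and> dball c (e / 4) \<noteq> {}"
      using open_dball centre_in_dball[of "e / 4" c] e by auto
    then obtain T where "open T" "T \<noteq> {}" "T \<subseteq> dball c (e / 4)" "T \<inter> F = {}"
      using F(2) unfolding nowhere_dense_iff_avoids by metis
    moreover from this obtain y s where "0 < s" "dball y s \<subseteq> T"
      using open_contains_dball by (metis ex_in_conv)
    ultimately show ?thesis by blast
  qed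
  then obtain y s where ys: "\<And>c. 0 < s c" "\<And>c. dball (y c) (s c) \<subseteq> dball c (e / 4) - F"
    by metis
  define r where "r = Min (insert (e / 2) (s ` N))"
  have "0 < r"
    using N(1) e ys(1) by (auto simp: r_def)
  moreover have "r \<le> e / 2" "\<And>c. c \<in> N \<Longrightarrow> r \<le> s c"
    unfolding r_def using N(1) by (intro Min_le; simp)+
  ultimately have r: "0 < r" "r \<le> e / 2" "\<And>c. c \<in> N \<Longrightarrow> r \<le> s c"
    by auto
  have "\<exists>y. dball y r \<subseteq> dball x e - F" for x
  proof (cases "dball x (e / 2) \<inter> F = {}")
    case True
    have "dball x r \<subseteq> dball x (e / 2)" "dball x (e / 2) \<subseteq> dball x e"
      using r(2) e by (auto simp: mem_dball)
    then show ?thesis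
      using True by blast
  next
    case False
    then obtain f c where f: "d x f < e / 2" "c \<in> N" "d c f < e / 4"
      using N(2) unfolding mem_dball[symmetric] by blast
    have "dball (y c) r \<subseteq> dball (y c) (s c)"
      using r(3)[OF f(2)] by (auto simp: mem_dball)
    moreover have "dball c (e / 4) \<subseteq> dball x e"
      using f d_triangle[of x c f] d_sym[of c f] by (intro dball_subset) auto
    ultimately show ?thesis
      using ys(2)[of c] by blast
  qed
  then show ?thesis
    using r(1) by blast
qed

text \<open>
  A set of small diameter acts on \<open>F\<close> almost like a single translation, and translations
  preserve holes; the factor \<open>2\<close> pays for the difference.
\<close>

lemma holes_of_sum_with_small_set:
  assumes holes: "\<And>x. \<exists>y. dball y (2 * s) \<subseteq> dball x r - F"
    and s: "0 < s" and small: "\<And>u v. u \<in> U \<Longrightarrow> v \<in> U \<Longrightarrow> d u v < s"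
  shows "\<exists>y. dball y s \<subseteq> dball x r - (F + U)"
proof (cases "U = {}")
  case True
  obtain y where "dball y (2 * s) \<subseteq> dball x r - F"
    using holes by blast
  moreover have "dball y s \<subseteq> dball y (2 * s)"
    using s by (auto simp: mem_dball)
  ultimately show ?thesis
    using True by (auto simp: set_plus_def)
next
  case False
  then obtain u where u: "u \<in> U" by blast
  obtain y where y: "dball y (2 * s) \<subseteq> dball (x - u) r - F"
    using holes by blast
  have "w \<in> dball x r - (F + U)" if w: "w \<in> dball (y + u) s" for w
  proof -
    have dw: "d y (w - u) < s"
      using w d_right_diff[of "y + u" u w] by (simp add: mem_dball)
    then have "w - u \<in> dball y (2 * s)"
      using s by (simp add: mem_dball)
    then have "w - u \<in> dball (x - u) r"
      using y by blast
    then have "w \<in> dball x r"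
      using d_right_diff[of x u w] by (simp add: mem_dball)
    moreover have "w \<notin> F + U"
    proof
      assume "w \<in> F + U"
      then obtain f v where fv: "f \<in> F" "v \<in> U" "w = f + v"
        by (auto simp: set_plus_def)
      have "d (w - u) f = d (f + v) (f + u)"
        using d_right_diff[of w u "f + u"] fv by simp
      then have "d (w - u) f < s"
        using small[OF fv(2) u] by (simp add: d_left)
      then have "d y f < 2 * s"
        using dw d_triangle[of y f "w - u"] by linarith
      then show False
        using y fv(1) by (auto simp: mem_dball)
    qed
    ultimately show ?thesis by blast
  qed
  then show ?thesis by blast
qed

text \<open>
  The compact sets are \<open>K m\<close>, the points covered by all groups from the \<open>m\<close>-th on, after the
  members of the cover have been replaced by the compact sets \<open>W n\<close>. The claim \<open>descend\<close> is the
  walk through consecutive indices; a single group beyond \<open>m\<close> and \<open>i\<close> then gives a hole of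
  \<open>F i + K m\<close> in a prescribed ball.
\<close>

lemma sharp_measure_zero_imp_sharply_meager_additive:
  fixes X :: "'a set" and C :: "nat \<Rightarrow> 'a set"
  assumes C: "\<And>n. compact (C n)" "mono C" "(\<Union>n. C n) = UNIV"
    and X: "sharp_measure_zero X"
  shows "sharply_meager_additive X"
  unfolding sharply_meager_additive_def
proof (intro allI impI)
  fix M :: "'a set" assume "meager M"
  then obtain N :: "nat \<Rightarrow> 'a set" where N: "\<And>n. nowhere_dense (N n)" "M = (\<Union>n. N n)"
    unfolding meager_def by blast
  define F where "F n = (\<Union>l\<le>n. closure (N l)) \<inter> C n" for n
  have F_compact: "compact (F n)" for n
    unfolding F_def by (intro closed_Int_compact C closed_UN) auto
  have F_nd: "nowhere_dense (F n)" for n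
    unfolding F_def
    by (rule nowhere_dense_subset[OF nowhere_dense_UN_atMost[of "\<lambda>l. closure (N l)" n]])
       (auto intro: nowhere_dense_closure N)
  have F_mono: "F i \<subseteq> F n" if "i \<le> n" for i n
    using monoD[OF C(2) that] that unfolding F_def by fastforce
  have MF: "M \<subseteq> (\<Union>n. F n)"
  proof
    fix x assume "x \<in> M"
    then obtain l where l: "x \<in> N l" using N(2) by blast
    obtain i where i: "x \<in> C i" using C(3) by blast
    have "x \<in> C (max l i)"
      using monoD[OF C(2), of i "max l i"] i by auto
    then have "x \<in> F (max l i)"
      using l closure_subset[of "N l"] unfolding F_def by auto
    then show "x \<in> (\<Union>n. F n)" by blast
  qed
  \<comment> \<open>Radii shrink so fast that any ball of radius \<open>r n\<close> has a hole of radius \<open>2 * r (Suc n)\<close>.\<close>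
  have "\<exists>r :: nat \<Rightarrow> real. \<forall>n. 0 < r n \<and>
          (r (Suc n) \<le> r n / 2 \<and> (\<forall>x. \<exists>y. dball y (2 * r (Suc n)) \<subseteq> dball x (r n) - F n))"
  proof (rule dependent_nat_choice)
    show "\<exists>x::real. 0 < x" by (rule exI[of _ 1]) simp
    fix r :: real and n assume "0 < r"
    then obtain s where s: "0 < s" "\<And>x. \<exists>y. dball y s \<subseteq> dball x r - F n"
      using compact_nowhere_dense_uniform_holes[OF F_compact[of n] F_nd[of n]] by metis
    have "\<exists>y. dball y (2 * min (r / 2) (s / 2)) \<subseteq> dball x r - F n" for x
    proof -
      obtain y where "dball y s \<subseteq> dball x r - F n" using s(2) by blast
      moreover have "dball y (2 * min (r / 2) (s / 2)) \<subseteq> dball y s"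
        by (auto simp: mem_dball)
      ultimately show ?thesis by blast
    qed
    then show "\<exists>s. 0 < s \<and> (s \<le> r / 2 \<and> (\<forall>x. \<exists>y. dball y (2 * s) \<subseteq> dball x r - F n))"
      using s(1) \<open>0 < r\<close> by (intro exI[of _ "min (r / 2) (s / 2)"]) auto
  qed
  then obtain r :: "nat \<Rightarrow> real" where r: "\<And>n. 0 < r n" "\<And>n. r (Suc n) \<le> r n / 2"
      "\<And>n x. \<exists>y. dball y (2 * r (Suc n)) \<subseteq> dball x (r n) - F n"
    by blast
  have "\<exists>h>0. \<forall>x\<in>C n. \<forall>y\<in>C n. dist x y < h \<longrightarrow> d x y < r (Suc n)" for n
    using d_modulus_on_compact[OF C(1) r(1)] by blast
  then obtain h where h: "\<And>n. 0 < h n"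
      "\<And>n x y. x \<in> C n \<Longrightarrow> y \<in> C n \<Longrightarrow> dist x y < h n \<Longrightarrow> d x y < r (Suc n)"
    by metis
  have "\<forall>n. 0 < h n / 2" using h(1) by simp
  then obtain U k where U: "\<And>n. bounded (U n)" "\<And>n. diameter (U n) \<le> h n / 2"
      and k: "k 0 = 0" "strict_mono k"
      and cov: "gamma_cover X (\<lambda>j. \<Union>n\<in>{k j..<k (Suc j)}. U n)"
    using X[unfolded sharp_measure_zero_def, rule_format, of "\<lambda>n. h n / 2"]
    unfolding gamma_groupable_cover_def by blast
  define W where "W n = closure (U n \<inter> C n)" for n
  have WC: "W n \<subseteq> C n" for n
    unfolding W_def using C(1)[of n] by (intro closure_minimal) (auto intro: compact_imp_closed)
  have W_compact: "compact (W n)" for n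
    using WC C(1)[of n] by (metis W_def closed_closure compact_Int_closed inf.absorb_iff2)
  have W_small: "d u v < r (Suc n)" if "u \<in> W n" "v \<in> W n" for u v n
  proof -
    have b: "bounded (W n)" "diameter (W n) \<le> h n / 2"
      unfolding W_def using U[of n] diameter_subset[of "U n \<inter> C n" "U n"]
      by (auto simp: diameter_closure bounded_Int)
    have "dist u v < h n"
      using diameter_bounded_bound[OF b(1) that] b(2) h(1)[of n] by linarith
    then show ?thesis
      using h(2) that WC by blast
  qed
  define K where "K m = (\<Inter>j\<in>{m..}. \<Union>n\<in>{k j..<k (Suc j)}. W n)" for m
  have K_compact: "compact (K m)" for m
  proof -
    have c: "compact (\<Union>n\<in>{k j..<k (Suc j)}. W n)" for j
      by (intro compact_UN W_compact) auto
    then have "closed (K m)"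
      unfolding K_def by (intro closed_INT) (auto intro: compact_imp_closed)
    moreover have "K m \<subseteq> (\<Union>n\<in>{k m..<k (Suc m)}. W n)"
      unfolding K_def by blast
    ultimately show ?thesis
      using c by (metis compact_Int_closed inf.absorb_iff2)
  qed
  have XK: "X \<subseteq> (\<Union>m. K m)"
  proof
    fix x assume x: "x \<in> X"
    then have "finite {j. x \<notin> (\<Union>n\<in>{k j..<k (Suc j)}. U n)}"
      using cov unfolding gamma_cover_def by blast
    then obtain b where b: "\<And>j. x \<notin> (\<Union>n\<in>{k j..<k (Suc j)}. U n) \<Longrightarrow> j < b"
      unfolding finite_nat_set_iff_bounded by blast
    obtain i where i: "x \<in> C i" using C(3) by blast
    have "x \<in> (\<Union>n\<in>{k j..<k (Suc j)}. W n)" if "max i b \<le> j" for j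
    proof -
      have "\<not> j < b" using that by simp
      then have "x \<in> (\<Union>n\<in>{k j..<k (Suc j)}. U n)" using b by blast
      then obtain n where n: "n \<in> {k j..<k (Suc j)}" "x \<in> U n" by blast
      have "i \<le> n"
        using seq_suble[OF k(2), of j] n(1) that by auto
      then have "x \<in> C n"
        using monoD[OF C(2)] i by blast
      then have "x \<in> W n"
        using n(2) closure_subset[of "U n \<inter> C n"] unfolding W_def by blast
      then show ?thesis using n(1) by blast
    qed
    then have "x \<in> K (max i b)" unfolding K_def by auto
    then show "x \<in> (\<Union>m. K m)" by blast
  qed
  have descend: "\<exists>y. dball y (r (n + l)) \<subseteq> dball x (r n) \<and>
      (\<forall>n'\<in>{n..<n + l}. dball y (r (n + l)) \<inter> (F n' + W n') = {})" for x n l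
  proof (induction l)
    case 0
    then show ?case by auto
  next
    case (Suc l)
    then obtain y where y: "dball y (r (n + l)) \<subseteq> dball x (r n)"
        "\<And>n'. n' \<in> {n..<n + l} \<Longrightarrow> dball y (r (n + l)) \<inter> (F n' + W n') = {}"
      by blast
    obtain z where z: "dball z (r (Suc (n + l))) \<subseteq> dball y (r (n + l)) - (F (n + l) + W (n + l))"
      using holes_of_sum_with_small_set[OF r(3) r(1) W_small] by blast
    have "dball z (r (n + Suc l)) \<inter> (F n' + W n') = {}" if "n' \<in> {n..<n + Suc l}" for n'
    proof (cases "n' = n + l")
      case True
      then show ?thesis using z by auto
    next
      case False
      then have "n' \<in> {n..<n + l}" using that by auto
      then show ?thesis using y(2) z by fastforce
    qed
    then show ?case using y(1) z by (intro exI[of _ z]) auto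
  qed
  have r_small: "\<exists>n0. \<forall>n\<ge>n0. r n < e" if "0 < e" for e
  proof -
    have le: "r n \<le> r 0 * (1 / 2) ^ n" for n
    proof (induction n)
      case (Suc n)
      then show ?case using r(2)[of n] by simp
    qed simp
    have "(\<lambda>n. r 0 * (1 / 2) ^ n) \<longlonglongrightarrow> 0"
      by (intro tendsto_mult_right_zero LIMSEQ_power_zero) simp
    then have "eventually (\<lambda>n. r 0 * (1 / 2) ^ n < e) sequentially"
      using that by (rule order_tendstoD)
    then show ?thesis
      using le unfolding eventually_sequentially by (meson le_less_trans)
  qed
  have nd: "nowhere_dense (F i + K m)" for i m
    unfolding nowhere_dense_iff_avoids
  proof (intro allI impI)
    fix S :: "'a set" assume "open S \<and> S \<noteq> {}"
    then obtain x e where xe: "0 < e" "dball x e \<subseteq> S"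
      using open_contains_dball by (metis ex_in_conv)
    obtain n0 where n0: "\<And>n. n0 \<le> n \<Longrightarrow> r n < e"
      using r_small[OF xe(1)] by blast
    define j where "j = max m (max i n0)"
    have kj: "i \<le> k j" "n0 \<le> k j" "k j < k (Suc j)"
      using seq_suble[OF k(2), of j] strict_monoD[OF k(2), of j "Suc j"] by (auto simp: j_def)
    obtain y where y: "dball y (r (k (Suc j))) \<subseteq> dball x (r (k j))"
        "\<And>n. n \<in> {k j..<k (Suc j)} \<Longrightarrow> dball y (r (k (Suc j))) \<inter> (F n + W n) = {}"
      using descend[where n="k j" and l="k (Suc j) - k j" and x=x] kj(3) by auto
    have "dball x (r (k j)) \<subseteq> dball x e"
      using n0[OF kj(2)] by (auto simp: mem_dball)
    moreover have "dball y (r (k (Suc j))) \<inter> (F i + K m) = {}"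
    proof -
      have False if "w \<in> dball y (r (k (Suc j)))" "w = f + v" "f \<in> F i" "v \<in> K m" for w f v
      proof -
        have "v \<in> (\<Union>n\<in>{k j..<k (Suc j)}. W n)"
          using that(4) unfolding K_def j_def by auto
        then obtain n where n: "n \<in> {k j..<k (Suc j)}" "v \<in> W n" by blast
        have "f \<in> F n"
          using F_mono[of i n] kj(1) n(1) that(3) by auto
        then have "w \<in> F n + W n"
          using n(2) that(2) by auto
        then show False using y(2)[OF n(1)] that(1) by blast
      qed
      then show ?thesis by (auto simp: set_plus_def)
    qed
    ultimately show "\<exists>T. open T \<and> T \<noteq> {} \<and> T \<subseteq> S \<and> T \<inter> (F i + K m) = {}"
      using xe(2) y(1) open_dball centre_in_dball[OF r(1)]
      by (intro exI[of _ "dball y (r (k (Suc j)))"]) blast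
  qed
  have "meager (M + (\<Union>m. K m))"
  proof (rule meager_if_covered[of "UNIV :: (nat \<times> nat) set" "\<lambda>(i, m). F i + K m"])
    show "M + (\<Union>m. K m) \<subseteq> (\<Union>p\<in>UNIV. case p of (i, m) \<Rightarrow> F i + K m)"
    proof
      fix w assume "w \<in> M + (\<Union>m. K m)"
      then obtain f v m where "f \<in> M" "v \<in> K m" "w = f + v"
        by (auto simp: set_plus_def)
      moreover from this obtain i where "f \<in> F i" using MF by blast
      ultimately show "w \<in> (\<Union>p\<in>UNIV. case p of (i, m) \<Rightarrow> F i + K m)"
        by auto
    qed
  qed (auto intro: nd)
  then show "\<exists>K. sigma_compact K \<and> X \<subseteq> K \<and> meager (M + K)"
    using K_compact XK unfolding sigma_compact_def by (intro exI[of _ "\<Union>m. K m"]) blast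
qed

end

section \<open>Assembling groupable covers\<close>

lemma consecutive_intervals_disjoint:
  fixes k :: "nat \<Rightarrow> nat"
  assumes k: "strict_mono k" and "k u \<le> n" "n < k (Suc u)" "k v \<le> n" "n < k (Suc v)"
  shows "u = v"
proof (rule ccontr)
  assume "u \<noteq> v"
  then have "Suc u \<le> v \<or> Suc v \<le> u" by auto
  then have "k (Suc u) \<le> k v \<or> k (Suc v) \<le> k u"
    using strict_mono_mono[OF k] by (auto dest: monoD)
  then show False using assms by auto
qed

text \<open>
  The \<open>j\<close>-th group covers the first \<open>j + 1\<close> pieces, one after another on consecutive blocks of
  indices; this is possible because each piece can be covered starting from any index. Every
  point is then missed by only finitely many groups.
\<close>

lemma gamma_groupable_cover_from_pieces:
  fixes Y :: "nat \<Rightarrow> 'a set" and small :: "nat \<Rightarrow> 'a set \<Rightarrow> bool"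
  assumes X: "X \<subseteq> (\<Union>p. Y p)"
    and pieces: "\<And>p m. \<exists>m' U. (\<forall>n. small n (U n)) \<and> Y p \<subseteq> (\<Union>n\<in>{m..<m'}. U n)"
  shows "\<exists>U. (\<forall>n. small n (U n)) \<and> gamma_groupable_cover X U"
proof -
  define fits where "fits j m m' U \<longleftrightarrow>
      (\<forall>n. small n (U n)) \<and> (\<Union>p\<le>j. Y p) \<subseteq> (\<Union>n\<in>{m..<m'}. U n)" for j m m' U
  have "\<exists>m'>m. \<exists>U. fits j m m' U" for j m
    unfolding fits_def
  proof (induction j)
    case 0
    obtain m' U where "\<forall>n. small n (U n)" "Y 0 \<subseteq> (\<Union>n\<in>{m..<m'}. U n)"
      using pieces[of 0 m] by blast
    moreover have "{m..<m'} \<subseteq> {m..<max m' (Suc m)}" by auto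
    ultimately show ?case
      by (intro exI[of _ "max m' (Suc m)"] conjI exI[of _ U]) (simp_all add: subset_trans[of _ "\<Union>n\<in>{m..<m'}. U n"] UN_mono)
  next
    case (Suc j)
    then obtain m1 U1 where 1: "m < m1" "\<forall>n. small n (U1 n)"
        "(\<Union>p\<le>j. Y p) \<subseteq> (\<Union>n\<in>{m..<m1}. U1 n)" by blast
    obtain m2 U2 where 2: "\<forall>n. small n (U2 n)" "Y (Suc j) \<subseteq> (\<Union>n\<in>{m1..<m2}. U2 n)"
      using pieces[of "Suc j" m1] by blast
    define U where "U n = (if n < m1 then U1 n else U2 n)" for n
    have U1: "(\<Union>n\<in>{m..<m1}. U1 n) \<subseteq> (\<Union>n\<in>{m..<max m1 m2}. U n)"
      unfolding U_def by (intro UN_least) force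
    have U2: "(\<Union>n\<in>{m1..<m2}. U2 n) \<subseteq> (\<Union>n\<in>{m..<max m1 m2}. U n)"
      unfolding U_def using 1(1) by (intro UN_least) force
    have "(\<Union>p\<le>Suc j. Y p) = (\<Union>p\<le>j. Y p) \<union> Y (Suc j)"
      by (simp add: atMost_Suc Un_commute)
    then have "(\<Union>p\<le>Suc j. Y p) \<subseteq> (\<Union>n\<in>{m..<max m1 m2}. U n)"
      using subset_trans[OF 1(3) U1] subset_trans[OF 2(2) U2] by simp
    then show ?case
      using 1 2 by (intro exI[of _ "max m1 m2"] conjI exI[of _ U]) (auto simp: U_def)
  qed
  then have "\<exists>g. \<forall>j m. m < g j m \<and> (\<exists>U. fits j m (g j m) U)"
    by (intro choice allI) blast
  then obtain g where g: "\<And>j m. m < g j m" "\<And>j m. \<exists>U. fits j m (g j m) U"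
    by blast
  then have "\<exists>U. \<forall>j m. fits j m (g j m) (U j m)"
    by (intro choice allI)
  then obtain U where "\<And>j m. fits j m (g j m) (U j m)"
    by blast
  then have gU: "\<And>j m n. small n (U j m n)"
      "\<And>j m. (\<Union>p\<le>j. Y p) \<subseteq> (\<Union>n\<in>{m..<g j m}. U j m n)"
    unfolding fits_def by blast+
  define k where "k = rec_nat (0 :: nat) g"
  have k0: "k 0 = 0" and kS: "k (Suc j) = g j (k j)" for j
    by (simp_all add: k_def)
  have k: "strict_mono k"
    unfolding strict_mono_Suc_iff kS using g(1) by blast
  define J where "J n = (THE j. k j \<le> n \<and> n < k (Suc j))" for n
  have J: "J n = j" if "n \<in> {k j..<k (Suc j)}" for n j
    unfolding J_def using that consecutive_intervals_disjoint[OF k] by (intro the_equality) auto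
  define W where "W n = U (J n) (k (J n)) n" for n
  have "gamma_cover X (\<lambda>j. \<Union>n\<in>{k j..<k (Suc j)}. W n)"
    unfolding gamma_cover_def
  proof (rule ballI)
    fix x assume "x \<in> X"
    then obtain p where p: "x \<in> Y p" using X by blast
    have tail: "x \<in> (\<Union>n\<in>{k j..<k (Suc j)}. W n)" if "p \<le> j" for j
    proof -
      have "x \<in> (\<Union>n\<in>{k j..<k (Suc j)}. U j (k j) n)"
        unfolding kS using gU(2)[of j "k j"] p that by blast
      then show ?thesis using J by (auto simp: W_def)
    qed
    have "{j. x \<notin> (\<Union>n\<in>{k j..<k (Suc j)}. W n)} \<subseteq> {..<p}"
    proof
      fix j assume "j \<in> {j. x \<notin> (\<Union>n\<in>{k j..<k (Suc j)}. W n)}"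
      then have "\<not> p \<le> j" using tail[of j] by blast
      then show "j \<in> {..<p}" by simp
    qed
    then show "finite {j. x \<notin> (\<Union>n\<in>{k j..<k (Suc j)}. W n)}"
      using finite_subset by blast
  qed
  then have "gamma_groupable_cover X W"
    using k0 k unfolding gamma_groupable_cover_def by (intro exI[of _ k] conjI)
  moreover have "\<forall>n. small n (W n)"
    unfolding W_def using gU(1) by simp
  ultimately show ?thesis by blast
qed

lemma sharp_measure_zero_from_pieces:
  fixes X :: "'a::metric_space set"
  assumes "\<And>\<epsilon> :: nat \<Rightarrow> real. (\<And>n. 0 < \<epsilon> n) \<Longrightarrow> \<exists>Y :: nat \<Rightarrow> 'a set. X \<subseteq> (\<Union>p. Y p) \<and>
    (\<forall>p m. \<exists>m' U. (\<forall>n. \<forall>x\<in>U n. \<forall>y\<in>U n. dist x y \<le> \<epsilon> n) \<and> Y p \<subseteq> (\<Union>n\<in>{m..<m'}. U n))"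
  shows "sharp_measure_zero X"
  unfolding sharp_measure_zero_def
proof (intro allI impI)
  fix \<epsilon> :: "nat \<Rightarrow> real" assume e: "\<forall>n. 0 < \<epsilon> n"
  obtain Y :: "nat \<Rightarrow> 'a set" where Y: "X \<subseteq> (\<Union>p. Y p)"
    "\<And>p m. \<exists>m' U. (\<forall>n. \<forall>x\<in>U n. \<forall>y\<in>U n. dist x y \<le> \<epsilon> n) \<and> Y p \<subseteq> (\<Union>n\<in>{m..<m'}. U n)"
    using assms[of \<epsilon>] e by blast
  obtain U where U: "\<forall>n. \<forall>x\<in>U n. \<forall>y\<in>U n. dist x y \<le> \<epsilon> n" "gamma_groupable_cover X U"
    using gamma_groupable_cover_from_pieces[OF Y(1),
        of "\<lambda>n S. \<forall>x\<in>S. \<forall>y\<in>S. dist x y \<le> \<epsilon> n"] Y(2) by blast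
  have "gamma_groupable_cover X (\<lambda>n. U n \<inter> X)"
  proof -
    have "{j. x \<notin> (\<Union>n\<in>D j. U n \<inter> X)} = {j. x \<notin> (\<Union>n\<in>D j. U n)}"
      if "x \<in> X" for x and D :: "nat \<Rightarrow> nat set"
      using that by auto
    then show ?thesis
      using U(2) unfolding gamma_groupable_cover_def gamma_cover_def by auto
  qed
  moreover have "bounded (U n \<inter> X) \<and> diameter (U n \<inter> X) \<le> \<epsilon> n" for n
    using e U(1) by (intro bounded_diameter_le) (auto simp: less_imp_le)
  ultimately show "\<exists>U. (\<forall>n. U n \<subseteq> X \<and> bounded (U n) \<and> diameter (U n) \<le> \<epsilon> n) \<and>
      gamma_groupable_cover X U"
    by (intro exI[of _ "\<lambda>n. U n \<inter> X"]) auto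
qed

section \<open>Meager-additive implies sharp measure zero\<close>

text \<open>
  A closed subspace of a locally compact metric space is again locally compact, hence Baire.
\<close>

lemma closed_subset_Baire_portion:
  fixes M :: "'a::metric_space set" and P :: "nat \<Rightarrow> 'a set"
  assumes "locally_compact_space (euclidean :: 'a topology)"
    and M: "closed M" "M \<noteq> {}" and P: "\<And>n. closed (P n)" "M \<subseteq> (\<Union>n. P n)"
  shows "\<exists>n S. open S \<and> S \<inter> M \<noteq> {} \<and> S \<inter> M \<subseteq> P n"
proof (rule ccontr)
  assume no: "\<not> ?thesis"
  have lc: "locally_compact_space (top_of_set M)"
    using assms(1) M(1) by (intro locally_compact_space_closed_subset) auto
  have reg: "regular_space (top_of_set M)"
    by (intro regular_space_subtopology metrizable_imp_regular_space metrizable_space_euclidean)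
  have "top_of_set M interior_of \<Union>(range (\<lambda>n. M \<inter> P n)) = {}"
  proof (rule Baire_category_alt)
    show "completely_metrizable_space (top_of_set M) \<or>
        locally_compact_space (top_of_set M) \<and> regular_space (top_of_set M)"
      using lc reg by blast
    fix T assume "T \<in> range (\<lambda>n. M \<inter> P n)"
    then obtain n where T: "T = M \<inter> P n" by blast
    have "top_of_set M interior_of T = {}"
    proof (rule ccontr)
      assume "top_of_set M interior_of T \<noteq> {}"
      then obtain R where R: "openin (top_of_set M) R" "R \<noteq> {}" "R \<subseteq> T"
        by (metis interior_of_subset openin_interior_of)
      then obtain S where "open S" "R = M \<inter> S"
        unfolding openin_open by blast
      then show False
        using no R T by blast
    qed
    moreover have "closedin (top_of_set M) T"
      unfolding T using P(1) by (simp add: closedin_closed_Int)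
    ultimately show "closedin (top_of_set M) T \<and> top_of_set M interior_of T = {}" by blast
  qed simp
  moreover have "\<Union>(range (\<lambda>n. M \<inter> P n)) = topspace (top_of_set M)"
    using P(2) by auto
  ultimately show False
    using M(2) by (metis interior_of_topspace topspace_euclidean_subtopology)
qed

text \<open>
  In a discrete space only the empty set is meager, so meager-additivity carries no
  information; but every singleton is then a member of the countable base, so the space is
  countable and the pieces can be single points.
\<close>

lemma discrete_imp_sharp_measure_zero:
  fixes X :: "'a::metric_space set" and V :: "nat \<Rightarrow> 'a set"
  assumes V: "\<And>S x. open S \<Longrightarrow> x \<in> S \<Longrightarrow> \<exists>n. x \<in> V n \<and> V n \<subseteq> S"
    and discrete: "\<And>x::'a. open {x}"
  shows "sharp_measure_zero X"
proof (rule sharp_measure_zero_from_pieces)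
  fix \<epsilon> :: "nat \<Rightarrow> real" assume e: "\<And>n. 0 < \<epsilon> n"
  define Y where "Y p = {x. V p = {x}}" for p :: nat
  have "X \<subseteq> (\<Union>p. Y p)"
    using V[OF discrete] unfolding Y_def by blast
  moreover have "\<exists>m' U. (\<forall>n. \<forall>x\<in>U n. \<forall>y\<in>U n. dist x y \<le> \<epsilon> n) \<and> Y p \<subseteq> (\<Union>n\<in>{m..<m'}. U n)"
    for p m
  proof (intro exI conjI)
    show "\<forall>n. \<forall>x\<in>Y p. \<forall>y\<in>Y p. dist x y \<le> \<epsilon> n"
      using e by (auto simp: Y_def less_imp_le)
    show "Y p \<subseteq> (\<Union>n\<in>{m..<Suc m}. Y p)" by simp
  qed
  ultimately show "\<exists>Y :: nat \<Rightarrow> 'a set. X \<subseteq> (\<Union>p. Y p) \<and>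
    (\<forall>p m. \<exists>m' U. (\<forall>n. \<forall>x\<in>U n. \<forall>y\<in>U n. dist x y \<le> \<epsilon> n) \<and> Y p \<subseteq> (\<Union>n\<in>{m..<m'}. U n))"
    by (intro exI[of _ Y] conjI allI)
qed

text \<open>
  The condition says that \<open>C\<close> is covered by \<open>I\<close> sets of the form \<open>{x. z - x \<in> W}\<close> with \<open>z\<close> outside a
  prescribed nowhere dense set. The point of the order of quantifiers is that \<open>I\<close> is chosen
  before \<open>N\<close>.
\<close>

definition translates_avoiding :: "nat \<Rightarrow> 'a::topological_group_add set \<Rightarrow> 'a set \<Rightarrow> bool" where
  "translates_avoiding I C W \<longleftrightarrow>
     (\<forall>N. nowhere_dense N \<longrightarrow> (\<exists>z :: nat \<Rightarrow> 'a. \<forall>x\<in>C. \<exists>i<I. z i \<notin> N \<and> z i - x \<in> W))"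

lemma translates_avoiding_mono:
  fixes C W :: "'a::topological_group_add set"
  assumes "translates_avoiding I C W" "I \<le> I'"
  shows "translates_avoiding I' C W"
  unfolding translates_avoiding_def
proof (intro allI impI)
  fix N :: "'a set" assume "nowhere_dense N"
  then obtain z where "\<forall>x\<in>C. \<exists>i<I. z i \<notin> N \<and> z i - x \<in> W"
    using assms(1) unfolding translates_avoiding_def by metis
  then show "\<exists>z :: nat \<Rightarrow> 'a. \<forall>x\<in>C. \<exists>i<I'. z i \<notin> N \<and> z i - x \<in> W"
    using assms(2) order.strict_trans2 by (intro exI[of _ z]) blast
qed

context biinvariant_metric
begin

text \<open>
  If \<open>w\<close> is the centre of a ball inside \<open>W\<close> and the points \<open>c i\<close> form a net of \<open>C\<close>, then the points
  \<open>w + c i\<close> would do, apart from possibly lying in \<open>N\<close>. A perturbation by less than the slack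
  left in the ball moves them off \<open>N\<close> without changing their number.
\<close>

lemma ex_translates_avoiding:
  fixes C W :: "'a set"
  assumes C: "compact C" and W: "open W" "W \<noteq> {}"
  shows "\<exists>I. translates_avoiding I C W"
proof -
  obtain w e where we: "0 < e" "dball w e \<subseteq> W"
    using W open_contains_dball by (metis ex_in_conv)
  obtain F where F: "finite F" "C \<subseteq> (\<Union>c\<in>F. dball c (e / 2))"
    using compact_finite_dnet[OF C, of "e / 2"] we(1) by auto
  obtain I c where Ic: "F = c ` {i::nat. i < I}"
    using F(1) unfolding finite_conv_nat_seg_image by blast
  have "translates_avoiding I C W"
    unfolding translates_avoiding_def
  proof (intro allI impI)
    fix N :: "'a set" assume N: "nowhere_dense N"
    have "\<exists>z. z \<in> dball (w + c i) (e / 2) - N" for i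
    proof -
      have "open (dball (w + c i) (e / 2)) \<and> dball (w + c i) (e / 2) \<noteq> {}"
        using open_dball centre_in_dball[of "e / 2" "w + c i"] we(1) by auto
      then show ?thesis
        using N unfolding nowhere_dense_iff_avoids by (metis Diff_iff disjoint_iff ex_in_conv subset_iff)
    qed
    then obtain z where z: "\<And>i. z i \<in> dball (w + c i) (e / 2) - N" by metis
    have "\<exists>i<I. z i \<notin> N \<and> z i - x \<in> W" if x: "x \<in> C" for x
    proof -
      obtain i where i: "i < I" "d (c i) x < e / 2"
        using F(2) x unfolding Ic mem_dball[symmetric] by blast
      have "d w (w + c i - x) = d (c i) x"
        using d_right_diff[of "w + x" x "w + c i"] by (simp add: d_left d_sym)
      moreover have "d (w + c i - x) (z i - x) < e / 2"
        using z[of i] by (simp add: d_right_diff mem_dball)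
      ultimately have "d w (z i - x) < e"
        using i(2) d_triangle[of w "z i - x" "w + c i - x"] by linarith
      then show ?thesis
        using i(1) z[of i] we(2) by (auto simp: mem_dball)
    qed
    then show "\<exists>z :: nat \<Rightarrow> 'a. \<forall>x\<in>C. \<exists>i<I. z i \<notin> N \<and> z i - x \<in> W" by blast
  qed
  then show ?thesis by blast
qed

text \<open>
  Keeping the centres of the balls away from \<open>0\<close> allows \<open>0\<close> to survive in the set that remains
  when the balls are removed; the Baire theorem needs a nonempty set.
\<close>

lemma punctured_dense_sequence:
  fixes V :: "nat \<Rightarrow> 'a set"
  assumes V: "\<And>n. open (V n)" "\<And>S x. open S \<Longrightarrow> x \<in> S \<Longrightarrow> \<exists>n. x \<in> V n \<and> V n \<subseteq> S"
    and nonisolated: "\<not> open {0::'a}"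
  shows "\<exists>q :: nat \<Rightarrow> 'a. (\<forall>n. q n \<noteq> 0) \<and> (\<forall>S. open S \<and> S \<noteq> {} \<longrightarrow> (\<exists>n. q n \<in> S))"
proof -
  have "\<exists>y. y \<noteq> 0 \<and> (V n \<noteq> {} \<longrightarrow> y \<in> V n)" for n
  proof (cases "V n = {}")
    case True
    have "(UNIV :: 'a set) \<noteq> {0}" using nonisolated by (metis open_UNIV)
    then show ?thesis using True by auto
  next
    case False
    then have "V n - {0} \<noteq> {}"
      using nonisolated V(1)[of n] by (metis Diff_eq_empty_iff subset_singletonD)
    then show ?thesis by blast
  qed
  then obtain q where q: "\<And>n. q n \<noteq> 0" "\<And>n. V n \<noteq> {} \<Longrightarrow> q n \<in> V n" by metis
  have "\<exists>n. q n \<in> S" if "open S" "S \<noteq> {}" for S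
  proof -
    from that(2) obtain x where "x \<in> S" by blast
    with V(2)[OF that(1)] obtain n where "x \<in> V n" "V n \<subseteq> S" by blast
    then show ?thesis using q(2)[of n] by blast
  qed
  then show ?thesis using q(1) by (intro exI[of _ q]) auto
qed

text \<open>
  \<open>A s\<close> consists of the balls removed before stage \<open>s\<close>, the ball of stage \<open>s\<close> having centre \<open>q s\<close> and
  radius \<open>e s\<close>. This ball will be used through at most \<open>I s\<close> reflected translates, for which the
  block of indices \<open>{k s..<k (Suc s)}\<close> is reserved. The order of choices is essential: \<open>I s\<close>
  is found from the balls removed before stage \<open>s\<close>, and the radius \<open>e s\<close> is chosen after \<open>I s\<close>, small for all indices of
  the block. The numbers \<open>I s\<close> increase because points \<open>z\<close> selected at stage \<open>s\<close> are also used
  with the balls of all later stages.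
\<close>

lemma hole_sequence:
  fixes C V :: "nat \<Rightarrow> 'a set" and q :: "nat \<Rightarrow> 'a" and h :: "nat \<Rightarrow> real"
  assumes C: "\<And>n. compact (C n)" and V: "\<And>n. open (V n)"
    and q: "\<And>n. q n \<noteq> 0" and h: "\<And>n. 0 < h n"
  obtains A :: "nat \<Rightarrow> 'a set" and k I :: "nat \<Rightarrow> nat" and e :: "nat \<Rightarrow> real"
  where "\<And>s. A (Suc s) = A s \<union> {y. d (q s) y \<le> e s}"
    and "\<And>s. 0 \<notin> A s" and "\<And>s. closed (A s)"
    and "\<And>s. k (Suc s) = k s + I s" and "mono I" and "\<And>s. 0 < I s"
    and "\<And>s. 0 < e s" and "\<And>s n. n \<in> {k s..<k (Suc s)} \<Longrightarrow> 4 * e s \<le> h n"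
    and "\<And>s a. a \<le> s \<Longrightarrow> V a - A s \<noteq> {} \<Longrightarrow> translates_avoiding (I s) (C s) (V a - A s)"
proof -
  define good :: "nat \<Rightarrow> 'a set \<times> nat \<times> nat \<times> real \<Rightarrow> bool" where
    "good s = (\<lambda>(A, k, I, e). closed A \<and> 0 \<notin> A \<and> 0 < I \<and> 0 < e \<and> e < d (q s) 0 \<and>
       (\<forall>n\<in>{k..<k + I}. 4 * e \<le> h n) \<and>
       (\<forall>a\<le>s. V a - A \<noteq> {} \<longrightarrow> translates_avoiding I (C s) (V a - A)))" for s
  define succ :: "nat \<Rightarrow> 'a set \<times> nat \<times> nat \<times> real \<Rightarrow> 'a set \<times> nat \<times> nat \<times> real \<Rightarrow> bool" where
    "succ s = (\<lambda>(A, k, I, e) (A', k', I', e').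
       A' = A \<union> {y. d (q s) y \<le> e} \<and> k' = k + I \<and> I \<le> I')" for s
  have extend: "\<exists>I e. I0 \<le> I \<and> good s (A, k, I, e)" if A: "closed A" "0 \<notin> A" for s A k I0
  proof -
    have "\<exists>I. V a - A \<noteq> {} \<longrightarrow> translates_avoiding I (C s) (V a - A)" for a
      using ex_translates_avoiding[OF C open_Diff[OF V A(1)]] by blast
    then obtain f where f: "\<And>a. V a - A \<noteq> {} \<Longrightarrow> translates_avoiding (f a) (C s) (V a - A)"
      by metis
    define I where "I = I0 + 1 + (\<Sum>a\<le>s. f a)"
    have fI: "f a \<le> I" if "a \<le> s" for a
      using member_le_sum[of a "{..s}" f] that by (simp add: I_def)
    define E where "E = insert (d (q s) 0 / 2) ((\<lambda>n. h n / 4) ` {k..<k + I})"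
    have d0: "0 < d (q s) 0"
      using q[of s] d_nonneg[of "q s" 0] d_zero[of "q s" 0] by linarith
    have E: "finite E" "E \<noteq> {}" by (simp_all add: E_def)
    have pos: "0 < Min E"
      using E d0 h by (auto simp: E_def)
    have "Min E \<le> d (q s) 0 / 2" by (rule Min_le[OF E(1)]) (simp add: E_def)
    then have lt: "Min E < d (q s) 0" using d0 by linarith
    have "4 * Min E \<le> h n" if "n \<in> {k..<k + I}" for n
    proof -
      have "Min E \<le> h n / 4" using that by (intro Min_le[OF E(1)]) (auto simp: E_def)
      then show ?thesis by linarith
    qed
    moreover have "translates_avoiding I (C s) (V a - A)" if "a \<le> s" "V a - A \<noteq> {}" for a
      using translates_avoiding_mono[OF f[OF that(2)] fI[OF that(1)]] .
    moreover have "0 < I" by (simp add: I_def)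
    ultimately have "good s (A, k, I, Min E)"
      using A pos lt unfolding good_def by blast
    then show ?thesis by (intro exI[of _ I] exI[of _ "Min E"]) (simp add: I_def)
  qed
  have "\<exists>st. \<forall>s. good s (st s) \<and> succ s (st s) (st (Suc s))"
  proof (rule dependent_nat_choice)
    show "\<exists>x. good 0 x" using extend[of "{}"] by (metis closed_empty empty_iff)
    fix x s assume x: "good s x"
    obtain A k I e where xe: "x = (A, k, I, e)" by (cases x)
    have "closed (A \<union> {y. d (q s) y \<le> e})" "0 \<notin> A \<union> {y. d (q s) y \<le> e}"
      using x xe closed_dcball by (auto simp: good_def)
    then obtain I' e' where "I \<le> I'" "good (Suc s) (A \<union> {y. d (q s) y \<le> e}, k + I, I', e')"
      using extend by blast
    then show "\<exists>y. good (Suc s) y \<and> succ s x y"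
      unfolding xe succ_def by auto
  qed
  then obtain st where st: "\<And>s. good s (st s)" "\<And>s. succ s (st s) (st (Suc s))" by blast
  define A k I e where "A s = fst (st s)" and "k s = fst (snd (st s))"
    and "I s = fst (snd (snd (st s)))" and "e s = snd (snd (snd (st s)))" for s
  have st_eq: "st s = (A s, k s, I s, e s)" for s
    by (simp add: A_def k_def I_def e_def)
  note g = st(1)[unfolded st_eq good_def, simplified] and sc = st(2)[unfolded st_eq succ_def, simplified]
  have "mono I" using sc by (intro incseq_SucI) auto
  then show ?thesis
    using g sc by (intro that[of A e k I]) simp_all
qed

text \<open>
  The interiors of the unions \<open>A s\<close> are removed, rather than the open balls, so that an open set
  meeting \<open>M\<close> is never contained in a single \<open>A s\<close>; its part outside \<open>A s\<close> is then a nonempty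
  open set, to which \<open>translates_avoiding\<close> applies.
\<close>

lemma meager_additive_imp_sharp_measure_zero:
  fixes X :: "'a set" and C V :: "nat \<Rightarrow> 'a set"
  assumes lc: "locally_compact_space (euclidean :: 'a topology)"
    and C: "\<And>n. compact (C n)" "mono C" "(\<Union>n. C n) = UNIV"
    and V: "\<And>n. open (V n)" "\<And>S x. open S \<Longrightarrow> x \<in> S \<Longrightarrow> \<exists>n. x \<in> V n \<and> V n \<subseteq> S"
    and nonisolated: "\<not> open {0::'a}"
    and X: "meager_additive X"
  shows "sharp_measure_zero X"
proof (rule sharp_measure_zero_from_pieces)
  fix \<epsilon> :: "nat \<Rightarrow> real" assume e: "\<And>n. 0 < \<epsilon> n"
  obtain q :: "nat \<Rightarrow> 'a" where q: "\<And>n. q n \<noteq> 0" "\<And>S. open S \<Longrightarrow> S \<noteq> {} \<Longrightarrow> \<exists>n. q n \<in> S"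
    using punctured_dense_sequence[of V, OF V nonisolated] by blast
  have "\<exists>h>0. \<forall>x\<in>C n. \<forall>y\<in>C n. d x y < h \<longrightarrow> dist x y < \<epsilon> n" for n
    using dist_modulus_on_compact[OF C(1) e] by blast
  then obtain h where h: "\<And>n. 0 < h n"
      "\<And>n x y. x \<in> C n \<Longrightarrow> y \<in> C n \<Longrightarrow> d x y < h n \<Longrightarrow> dist x y < \<epsilon> n"
    by metis
  obtain A :: "nat \<Rightarrow> 'a set" and k I :: "nat \<Rightarrow> nat" and r :: "nat \<Rightarrow> real" where
    A: "\<And>s. A (Suc s) = A s \<union> {y. d (q s) y \<le> r s}" "\<And>s. 0 \<notin> A s" "\<And>s. closed (A s)" and
    k: "\<And>s. k (Suc s) = k s + I s" and I: "mono I" "\<And>s. 0 < I s" and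
    r: "\<And>s. 0 < r s" "\<And>s n. n \<in> {k s..<k (Suc s)} \<Longrightarrow> 4 * r s \<le> h n" and
    avoid: "\<And>s a. a \<le> s \<Longrightarrow> V a - A s \<noteq> {} \<Longrightarrow> translates_avoiding (I s) (C s) (V a - A s)"
    by (rule hole_sequence[of C V q h, OF C(1) V(1) q(1) h(1)], rule that)
  have k_mono: "strict_mono k"
    using k I(2) by (simp add: strict_mono_Suc_iff)
  have between: "\<exists>u\<in>{s..<t}. d (q u) y \<le> r u" if "y \<in> A t" "y \<notin> A s" for s t y
    using that(1)
  proof (induction t)
    case 0
    have "A 0 \<subseteq> A s" using lift_Suc_mono_le[of A 0 s] A(1) by auto
    then show ?case using 0 that(2) by blast
  next
    case (Suc t)
    show ?case
    proof (cases "y \<in> A t")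
      case True
      then show ?thesis using Suc.IH by force
    next
      case False
      have "s \<le> t"
      proof (rule ccontr)
        assume "\<not> s \<le> t"
        then have "A (Suc t) \<subseteq> A s" using lift_Suc_mono_le[of A "Suc t" s] A(1) by auto
        then show False using Suc.prems that(2) by blast
      qed
      then show ?thesis using False Suc.prems A(1)[of t] by (intro bexI[of _ t]) auto
    qed
  qed
  define M where "M = - (\<Union>s. interior (A s))"
  have M_closed: "closed M" unfolding M_def by (intro closed_Compl open_UN) auto
  have M_zero: "0 \<in> M" using A(2) interior_subset unfolding M_def by blast
  have "nowhere_dense M"
    unfolding nowhere_dense_iff_avoids
  proof (intro allI impI)
    fix S :: "'a set" assume S: "open S \<and> S \<noteq> {}"
    then obtain n where n: "q n \<in> S" using q(2) by blast
    have "dball (q n) (r n) \<subseteq> A (Suc n)" unfolding A(1) by (auto simp: mem_dball)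
    then have "dball (q n) (r n) \<subseteq> interior (A (Suc n))"
      using open_dball by (rule interior_maximal)
    then have "dball (q n) (r n) \<inter> M = {}" unfolding M_def by blast
    then show "\<exists>T. open T \<and> T \<noteq> {} \<and> T \<subseteq> S \<and> T \<inter> M = {}"
      using S n open_dball centre_in_dball[OF r(1)]
      by (intro exI[of _ "S \<inter> dball (q n) (r n)"]) (auto intro: open_Int)
  qed
  then have "meager M"
    by (intro meager_if_covered[of "UNIV :: nat set" "\<lambda>_. M"]) auto
  then have "meager (M + X)"
    using X unfolding meager_additive_def by blast
  then obtain N where N: "\<And>l::nat. nowhere_dense (N l)" "M + X = (\<Union>l. N l)"
    unfolding meager_def by blast
  define Y where "Y = (\<lambda>(a, l, i). if V a \<inter> M = {} then {} else
      C i \<inter> (\<Inter>y\<in>V a \<inter> M. (\<lambda>x. y + x) -` closure (N l)))"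
  have cover: "X \<subseteq> (\<Union>p. Y p)"
  proof
    fix x assume x: "x \<in> X"
    define P where "P l = (\<lambda>y. y + x) -` closure (N l)" for l
    have "closed (P l)" for l
      unfolding P_def by (intro closed_vimage closed_closure continuous_intros)
    moreover have "M \<subseteq> (\<Union>l. P l)"
    proof
      fix y assume "y \<in> M"
      then have "y + x \<in> (\<Union>l. N l)" using x N(2) by blast
      then show "y \<in> (\<Union>l. P l)" using closure_subset unfolding P_def by blast
    qed
    ultimately obtain l S where lS: "open S" "S \<inter> M \<noteq> {}" "S \<inter> M \<subseteq> P l"
      using closed_subset_Baire_portion[OF lc M_closed, of P] M_zero by blast
    then obtain v where v: "v \<in> S" "v \<in> M" by blast
    then obtain a where a: "v \<in> V a" "V a \<subseteq> S" using V(2)[OF lS(1)] by blast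
    obtain i where "x \<in> C i" using C(3) by blast
    then have "x \<in> Y (a, l, i)"
      using a v(2) lS(3) unfolding Y_def P_def by auto
    then show "x \<in> (\<Union>p. Y p)" by blast
  qed
  have piece: "\<exists>m' U. (\<forall>n. \<forall>x\<in>U n. \<forall>y\<in>U n. dist x y \<le> \<epsilon> n) \<and> Y p \<subseteq> (\<Union>n\<in>{m..<m'}. U n)" for p m
  proof -
    obtain a l i where p: "p = (a, l, i)" by (cases p)
    show ?thesis
    proof (cases "V a \<inter> M = {}")
      case True
      then show ?thesis by (intro exI[of _ m] exI[of _ "\<lambda>_. {}"]) (simp add: p Y_def)
    next
      case False
      then have Y: "Y p = C i \<inter> (\<Inter>y\<in>V a \<inter> M. (\<lambda>x. y + x) -` closure (N l))"
        by (simp add: p Y_def)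
      have Y_compact: "compact (Y p)"
        unfolding Y by (intro compact_Int_closed C closed_INT ballI closed_vimage closed_closure continuous_intros)
      define s where "s = max a (max i m)"
      have "V a - A s \<noteq> {}"
      proof
        assume "V a - A s = {}"
        then have "V a \<subseteq> interior (A s)" using V(1) by (intro interior_maximal) auto
        then show False using False unfolding M_def by blast
      qed
      then have "translates_avoiding (I s) (C s) (V a - A s)"
        by (intro avoid) (simp_all add: s_def)
      then obtain z where z: "\<And>x. x \<in> C s \<Longrightarrow> \<exists>j<I s. z j \<notin> closure (N l) \<and> z j - x \<in> V a - A s"
        using nowhere_dense_closure[OF N(1)[of l]] unfolding translates_avoiding_def by blast
      \<comment> \<open>The radius is doubled to make the sets open, so that compactness leaves finitely many.\<close>
      define G where "G u = (\<Union>j<I s. {x. d (z j - x) (q u) < 2 * r u})" for u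
      have G_open: "open (G u)" for u
        unfolding G_def by (intro open_UN ballI open_Collect_less continuous_on_d continuous_intros)
      have "Y p \<subseteq> (\<Union>u\<in>{s..}. G u)"
      proof
        fix x assume x: "x \<in> Y p"
        have "C i \<subseteq> C s" by (intro monoD[OF C(2)]) (simp add: s_def)
        then obtain j where j: "j < I s" "z j \<notin> closure (N l)" "z j - x \<in> V a - A s"
          using z x Y by blast
        \<comment> \<open>Otherwise \<open>z j = (z j - x) + x\<close> would lie in \<open>closure (N l)\<close>.\<close>
        have "(z j - x) + x \<notin> closure (N l)" "z j - x \<in> V a"
          using j by simp_all
        then have "z j - x \<notin> M"
          using x unfolding Y by blast
        then obtain t where "z j - x \<in> interior (A t)"
          unfolding M_def by blast
        then have "z j - x \<in> A t"
          using interior_subset by blast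
        moreover have "z j - x \<notin> A s"
          using j(3) by blast
        ultimately obtain u where u: "u \<in> {s..<t}" "d (q u) (z j - x) \<le> r u"
          using between by blast
        have "d (z j - x) (q u) < 2 * r u"
          using u(2) r(1)[of u] by (simp add: d_sym)
        then show "x \<in> (\<Union>u\<in>{s..}. G u)" using u(1) j(1) unfolding G_def by auto
      qed
      then obtain D where D: "D \<subseteq> {s..}" "finite D" "Y p \<subseteq> (\<Union>u\<in>D. G u)"
        using compactE_image[OF Y_compact, of "{s..}" G] G_open by metis
      obtain t where t: "\<And>u. u \<in> D \<Longrightarrow> u < t"
        using D(2) unfolding finite_nat_set_iff_bounded by blast
      \<comment> \<open>The index \<open>n = k u + j\<close> belongs to the translate of the ball of stage \<open>u\<close> by \<open>z j\<close>.\<close>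
      define U where "U n = {x \<in> Y p. \<exists>u\<ge>s. k u \<le> n \<and> n < k (Suc u) \<and>
          d (z (n - k u) - x) (q u) < 2 * r u}" for n
      have "dist x y \<le> \<epsilon> n" if xy: "x \<in> U n" "y \<in> U n" for x y n
      proof -
        obtain u where u: "s \<le> u" "k u \<le> n" "n < k (Suc u)" "d (z (n - k u) - x) (q u) < 2 * r u"
          using xy(1) unfolding U_def by blast
        have uy: "d (z (n - k u) - y) (q u) < 2 * r u"
          using xy(2) consecutive_intervals_disjoint[OF k_mono u(2,3)] unfolding U_def by blast
        have "d x y < 4 * r u"
          using u(4) uy d_triangle[of "z (n - k u) - x" "z (n - k u) - y" "q u"]
            d_left_diff[of "z (n - k u)" x y] d_sym[of "q u" "z (n - k u) - y"] by linarith
        then have "d x y < h n" using r(2)[of n u] u(2,3) by auto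
        moreover have "C i \<subseteq> C n"
          using u(1,2) seq_suble[OF k_mono, of u] by (intro monoD[OF C(2)]) (simp add: s_def)
        moreover have "x \<in> C i" "y \<in> C i"
          using xy unfolding U_def Y by auto
        ultimately have "dist x y < \<epsilon> n"
          using h(2)[of x n y] by blast
        then show ?thesis by simp
      qed
      moreover have "Y p \<subseteq> (\<Union>n\<in>{m..<k t}. U n)"
      proof
        fix x assume x: "x \<in> Y p"
        then obtain u j where u: "u \<in> D" "j < I s" "d (z j - x) (q u) < 2 * r u"
          using D(3) unfolding G_def by blast
        have su: "s \<le> u" using D(1) u(1) by auto
        have "j < I u" using u(2) monoD[OF I(1) su] by simp
        then have n: "k u + j < k (Suc u)" using k by simp
        have "d (z (k u + j - k u) - x) (q u) < 2 * r u"
          using u(3) by simp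
        then have "x \<in> U (k u + j)"
          unfolding U_def using x su n le_add1[of "k u" j] by blast
        moreover have "k (Suc u) \<le> k t"
          using t[OF u(1)] by (intro monoD[OF strict_mono_mono[OF k_mono]]) simp
        moreover have "m \<le> k u"
          using su seq_suble[OF k_mono, of u] by (simp add: s_def)
        ultimately have "k u + j \<in> {m..<k t}" "x \<in> U (k u + j)"
          using n by simp_all
        then show "x \<in> (\<Union>n\<in>{m..<k t}. U n)" by blast
      qed
      ultimately show ?thesis by blast
    qed
  qed
  have "X \<subseteq> (\<Union>p. Y (from_nat p))"
  proof
    fix x assume "x \<in> X"
    then obtain p where "x \<in> Y p" using cover by blast
    then have "x \<in> Y (from_nat (to_nat p))" by simp
    then show "x \<in> (\<Union>p. Y (from_nat p))" by blast
  qed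
  then show "\<exists>Y :: nat \<Rightarrow> 'a set. X \<subseteq> (\<Union>p. Y p) \<and>
    (\<forall>p m. \<exists>m' U. (\<forall>n. \<forall>x\<in>U n. \<forall>y\<in>U n. dist x y \<le> \<epsilon> n) \<and> Y p \<subseteq> (\<Union>n\<in>{m..<m'}. U n))"
    by (rule exI[of _ "\<lambda>p. Y (from_nat p)", OF conjI]) (rule allI, rule allI, rule piece)
qed

lemma discrete_if_zero_isolated:
  assumes "open {0::'a}"
  shows "open {x::'a}"
proof -
  obtain s where s: "0 < s" "dball 0 s \<subseteq> {0}"
    using open_contains_dball[OF assms singletonI] by blast
  have "dball x s = {x}"
  proof -
    have "y = x" if "y \<in> dball x s" for y
    proof -
      have "y - x \<in> dball 0 s"
        using that d_right_diff[of x x y] by (simp add: mem_dball)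
      then have "y - x = 0" using s(2) by blast
      then show ?thesis by simp
    qed
    then show ?thesis using centre_in_dball[OF s(1), of x] by blast
  qed
  then show ?thesis using open_dball[of x s] by simp
qed

end

theorem theorem1p4:
  fixes X :: "'a::{topological_group_add, metric_space} set"
  assumes "separable_space (euclidean :: 'a topology)"
    and "locally_compact_space (euclidean :: 'a topology)"
    and "\<exists>d :: 'a \<Rightarrow> 'a \<Rightarrow> real. invariant_metric d"
  shows "(meager_additive X \<longleftrightarrow> sharply_meager_additive X) \<and>
         (sharply_meager_additive X \<longleftrightarrow> sharp_measure_zero X)"
proof -
  obtain d :: "'a \<Rightarrow> 'a \<Rightarrow> real" where "invariant_metric d"
    using assms(3) by (elim exE)
  then interpret biinvariant_metric d by (rule biinvariant_metric.intro)
  obtain C :: "nat \<Rightarrow> 'a set" where "(\<forall>n. compact (C n)) \<and> mono C \<and> (\<Union>n. C n) = UNIV"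
    using compact_exhaustion_sequence[OF assms(1,2)] by (elim exE)
  then have C: "\<And>n. compact (C n)" "mono C" "(\<Union>n. C n) = UNIV" by auto
  obtain V :: "nat \<Rightarrow> 'a set" where V': "(\<forall>n. open (V n)) \<and>
      (\<forall>S x. open S \<and> x \<in> S \<longrightarrow> (\<exists>n. x \<in> V n \<and> V n \<subseteq> S))"
    using countable_base_sequence[OF assms(1)] by (elim exE)
  have V: "\<And>n. open (V n)" "\<And>S x. open S \<Longrightarrow> x \<in> S \<Longrightarrow> \<exists>n. x \<in> V n \<and> V n \<subseteq> S"
    using V' by simp_all
  have "sharply_meager_additive X" if "sharp_measure_zero X"
    using C that by (rule sharp_measure_zero_imp_sharply_meager_additive)
  moreover have "meager_additive X" if sharp: "sharply_meager_additive X"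
    unfolding meager_additive_def
  proof (intro allI impI)
    fix M :: "'a set" assume "meager M"
    then obtain K where K: "X \<subseteq> K" "meager (M + K)"
      using sharp unfolding sharply_meager_additive_def by blast
    show "meager (M + X)"
      by (rule meager_subset[OF K(2) set_plus_mono2[OF subset_refl K(1)]])
  qed
  moreover have "sharp_measure_zero X" if "meager_additive X"
  proof (cases "open {0::'a}")
    case True
    show ?thesis
      using V(2) discrete_if_zero_isolated[OF True] by (rule discrete_imp_sharp_measure_zero)
  next
    case False
    with assms(2) C V show ?thesis
      using that by (rule meager_additive_imp_sharp_measure_zero)
  qed
  ultimately show ?thesis by blast
qed

end
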